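(* Let $M\ge 2$ and $K_{\max}\ge 1$ be integers. For every way of making its choices, the optimal schedule design algorithm (described in the context) run on input $(M,K_{\max})$ is well defined (the exchange sought in every iteration of its load-balancing phase exists), terminates after finitely many steps, and returns $R$, $w$ and a family $\mathcal F$ of $M$ distinct $w$-element subsets of $[R]$ such that $R=R_{\rm cw}^\star$, where $$R_{\rm cw}^\star=\min\left\{R\in\mathbb N:\ \exists\, w\in[R]\ \text{such that}\ \binom{R}{w}\ge M\ \text{and}\ Mw\le RK_{\max}\right\},$$ and $$\max_{r\in[R]}K_r=\left\lceil\frac{Mw}{R}\right\rceil\le K_{\max},$$ where $K_r$ is the number of members of $\mathcal F$ containing $r$. Consequently, $\mathcal F$ gives an optimal schedule within the constant-weight class: it is the family of codeword supports of a bidirectionally feasible constant-weight schedule satisfying the concurrency limit $K_{\max}$, with the minimum number of rounds among all bidirectionally feasible constant-weight schedules for $M$ non-reference nodes satisfying that limit.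
   Context: $\mathbb N$ is the set of positive integers and $[R]=\{1,\dots,R\}$. Schedules: a schedule with $R$ rounds for $M$ non-reference nodes is a matrix in $\{0,1\}^{R\times M}$ whose $M$ columns are the nodes' codewords; entry $1$ in row $r$ means the node transmits in round $r$, and $0$ means it listens. The support of a codeword is the set of rounds in which it equals $1$. The schedule is constant-weight if all columns have the same number $w\in[R]$ of ones; it is bidirectionally feasible if for every ordered pair of distinct nodes there is a round in which the first transmits and the second listens; it satisfies the concurrency limit $K_{\max}$ if every row has at most $K_{\max}$ ones. Algorithm, on input $(M,K_{\max})$: (Parameter search.) Start with $R=R_\infty^\star=\min\{R\in\mathbb N:\binom{R}{\lfloor R/2\rfloor}\ge M\}$. For the current $R$ put $w_R=\min\{w\in\{1,\dots,\lfloor R/2\rfloor\}:\binom{R}{w}\ge M\}$ and set $w=w_R$. If $Mw\le RK_{\max}$, stop the search with this $(R,w)$; otherwise increase $R$ by one and repeat. (Initialization.) Select any family $\mathcal F$ of $M$ distinct $w$-element subsets of $[R]$, and let $K_r=|\{\mathcal A\in\mathcal F:r\in\mathcal A\}|$ for $r\in[R]$. (Load balancing.) While $\max_rK_r-\min_rK_r>1$: choose $a\in\operatorname{arg\,max}_rK_r$ and $b\in\operatorname{arg\,min}_rK_r$; find $\mathcal A\in\mathcal F$ with $a\in\mathcal A$, $b\notin\mathcal A$ and $\mathcal A'=(\mathcal A\setminus\{a\})\cup\{b\}\notin\mathcal F$; replace $\mathcal A$ by $\mathcal A'$ in $\mathcal F$ and update $K_a\leftarrow K_a-1$, $K_b\leftarrow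 K_b+1$. Return $R$, $w$, $\mathcal F$. *)

theory Defs
  imports Complex_Main
begin

text \<open>A schedule is a 0/1 matrix: \<open>S r m\<close> is the entry in row (round) \<open>r\<close> and column (node) \<open>m\<close>.
  Rounds are \<open>{1..R}\<close> and nodes are \<open>{1..M}\<close>; values outside these ranges are irrelevant.\<close>

definition schedule :: "nat \<Rightarrow> nat \<Rightarrow> (nat \<Rightarrow> nat \<Rightarrow> nat) \<Rightarrow> bool" where
  "schedule R M S \<longleftrightarrow> (\<forall>r\<in>{1..R}. \<forall>m\<in>{1..M}. S r m \<in> {0, 1})"

definition codeword_support :: "nat \<Rightarrow> (nat \<Rightarrow> nat \<Rightarrow> nat) \<Rightarrow> nat \<Rightarrow> nat set" where
  "codeword_support R S m = {r \<in> {1..R}. S r m = 1}"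

definition constant_weight :: "nat \<Rightarrow> nat \<Rightarrow> (nat \<Rightarrow> nat \<Rightarrow> nat) \<Rightarrow> bool" where
  "constant_weight R M S \<longleftrightarrow> (\<exists>w\<in>{1..R}. \<forall>m\<in>{1..M}. card (codeword_support R S m) = w)"

definition bidirectionally_feasible :: "nat \<Rightarrow> nat \<Rightarrow> (nat \<Rightarrow> nat \<Rightarrow> nat) \<Rightarrow> bool" where
  "bidirectionally_feasible R M S \<longleftrightarrow>
     (\<forall>i\<in>{1..M}. \<forall>j\<in>{1..M}. i \<noteq> j \<longrightarrow> (\<exists>r\<in>{1..R}. S r i = 1 \<and> S r j = 0))"

definition concurrency_limited :: "nat \<Rightarrow> nat \<Rightarrow> nat \<Rightarrow> (nat \<Rightarrow> nat \<Rightarrow> nat) \<Rightarrow> bool" where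
  "concurrency_limited Kmax R M S \<longleftrightarrow> (\<forall>r\<in>{1..R}. card {m \<in> {1..M}. S r m = 1} \<le> Kmax)"

definition feasible_cw_schedule :: "nat \<Rightarrow> nat \<Rightarrow> nat \<Rightarrow> (nat \<Rightarrow> nat \<Rightarrow> nat) \<Rightarrow> bool" where
  "feasible_cw_schedule Kmax R M S \<longleftrightarrow>
     schedule R M S \<and> constant_weight R M S \<and> bidirectionally_feasible R M S \<and>
     concurrency_limited Kmax R M S"

text \<open>\<open>LEAST\<close> and \<open>Min\<close> are meaningful only where the underlying set is nonempty; the
  algorithm below is blocked, and the main theorem asserts membership, accordingly.\<close>

definition unconstrained_rounds :: "nat \<Rightarrow> nat set" where
  "unconstrained_rounds M = {R. R \<ge> 1 \<and> R choose (R div 2) \<ge> M}"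

definition R_inf_star :: "nat \<Rightarrow> nat" where
  "R_inf_star M = (LEAST R. R \<in> unconstrained_rounds M)"

definition weight_candidates :: "nat \<Rightarrow> nat \<Rightarrow> nat set" where
  "weight_candidates M R = {w \<in> {1..R div 2}. R choose w \<ge> M}"

definition min_weight :: "nat \<Rightarrow> nat \<Rightarrow> nat" where
  "min_weight M R = Min (weight_candidates M R)"

definition cw_rounds :: "nat \<Rightarrow> nat \<Rightarrow> nat set" where
  "cw_rounds M Kmax =
     {R. R \<ge> 1 \<and> (\<exists>w\<in>{1..R}. R choose w \<ge> M \<and> M * w \<le> R * Kmax)}"

definition R_cw_star :: "nat \<Rightarrow> nat \<Rightarrow> nat" where
  "R_cw_star M Kmax = (LEAST R. R \<in> cw_rounds M Kmax)"

definition subset_family :: "nat \<Rightarrow> nat \<Rightarrow> nat \<Rightarrow> nat set set \<Rightarrow> bool" where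
  "subset_family M R w F \<longleftrightarrow> finite F \<and> card F = M \<and> (\<forall>A\<in>F. A \<subseteq> {1..R} \<and> card A = w)"

definition load :: "nat set set \<Rightarrow> nat \<Rightarrow> nat" where
  "load F r = card {A \<in> F. r \<in> A}"

definition max_load :: "nat \<Rightarrow> (nat \<Rightarrow> nat) \<Rightarrow> nat" where
  "max_load R K = Max (K ` {1..R})"

definition min_load :: "nat \<Rightarrow> (nat \<Rightarrow> nat) \<Rightarrow> nat" where
  "min_load R K = Min (K ` {1..R})"

definition exchangeable :: "nat set set \<Rightarrow> nat \<Rightarrow> nat \<Rightarrow> nat set \<Rightarrow> bool" where
  "exchangeable F a b A \<longleftrightarrow> A \<in> F \<and> a \<in> A \<and> b \<notin> A \<and> insert b (A - {a}) \<notin> F"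

text \<open>The algorithm is a nondeterministic transition system, one transition per choice.
  \<open>Exchange\<close> is the point inside a load-balancing iteration where \<open>a\<close> and \<open>b\<close> have already been
  chosen and the exchange set is still to be found; as a separate configuration, it is stuck
  whenever some choice of \<open>a\<close>, \<open>b\<close> admits no exchange. The load vector \<open>K\<close> is computed
  once and then only updated incrementally.\<close>

datatype config =
    Start
  | Search nat
  | Initialize nat nat
  | Balance nat nat "nat set set" "nat \<Rightarrow> nat"
  | Exchange nat nat "nat set set" "nat \<Rightarrow> nat" nat nat
  | Returned nat nat "nat set set"

inductive step :: "nat \<Rightarrow> nat \<Rightarrow> config \<Rightarrow> config \<Rightarrow> bool" for M Kmax :: nat where
  start: "unconstrained_rounds M \<noteq> {} \<Longrightarrow> step M Kmax Start (Search (R_inf_star M))"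
| search_stop: "weight_candidates M R \<noteq> {} \<Longrightarrow> M * min_weight M R \<le> R * Kmax \<Longrightarrow>
    step M Kmax (Search R) (Initialize R (min_weight M R))"
| search_next: "weight_candidates M R \<noteq> {} \<Longrightarrow> \<not> M * min_weight M R \<le> R * Kmax \<Longrightarrow>
    step M Kmax (Search R) (Search (R + 1))"
| initialize: "subset_family M R w F \<Longrightarrow>
    step M Kmax (Initialize R w) (Balance R w F (load F))"
| choose_rounds: "max_load R K > min_load R K + 1 \<Longrightarrow>
    is_arg_max K (\<lambda>r. r \<in> {1..R}) a \<Longrightarrow> is_arg_min K (\<lambda>r. r \<in> {1..R}) b \<Longrightarrow>
    step M Kmax (Balance R w F K) (Exchange R w F K a b)"
| exchange: "exchangeable F a b A \<Longrightarrow>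
    step M Kmax (Exchange R w F K a b)
      (Balance R w (insert (insert b (A - {a})) (F - {A})) (K(a := K a - 1, b := K b + 1)))"
| finish: "\<not> max_load R K > min_load R K + 1 \<Longrightarrow>
    step M Kmax (Balance R w F K) (Returned R w F)"

definition reachable :: "nat \<Rightarrow> nat \<Rightarrow> config \<Rightarrow> bool" where
  "reachable M Kmax = (step M Kmax)\<^sup>*\<^sup>* Start"

end

(* Search: if some weight is admissible for R, then so is min_weight, because it is the smallest
   weight up to R div 2 with enough codewords; hence the search stops exactly at the least element
   of cw_rounds, which exists because R = M, w = 1 is admissible.
   Balancing: if a is more loaded than b, then more members of the family contain a but not b than
   the other way round, so the injective map exchanging a for b must leave the family somewhere.
   Each exchange across a gap of at least 2 decreases the sum of the squared loads.  When the gap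
   is at most 1, the maximum is the rounded-up average, since the loads sum to M * w. *)
theory Submission
  imports Defs
begin

section \<open>Parameter search\<close>

text \<open>The central binomial coefficient is the largest in its row, hence at least
  \<open>M choose 1\<close>. This makes the minimum defining \<open>R_inf_star\<close>
  meaningful.\<close>

lemma mem_unconstrained_rounds_self:
  assumes "M \<ge> 2"
  shows "M \<in> unconstrained_rounds M"
  using assms binomial_maximum[of M 1] by (simp add: unconstrained_rounds_def)

lemma R_inf_star_mem:
  assumes "M \<ge> 2"
  shows "R_inf_star M \<in> unconstrained_rounds M"
  unfolding R_inf_star_def using mem_unconstrained_rounds_self[OF assms] by (rule LeastI)

text \<open>For one round the central coefficient is 1, below \<open>M\<close>. The bound is what
  makes \<open>R div 2\<close> a positive weight later.\<close>

lemma R_inf_star_ge_2: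
  assumes "M \<ge> 2"
  shows "R_inf_star M \<ge> 2"
proof (rule ccontr)
  assume "\<not> ?thesis"
  moreover have "R_inf_star M \<ge> 1" "R_inf_star M choose (R_inf_star M div 2) \<ge> M"
    using R_inf_star_mem[OF assms] by (auto simp: unconstrained_rounds_def)
  ultimately have "R_inf_star M = 1" by linarith
  with \<open>R_inf_star M choose (R_inf_star M div 2) \<ge> M\<close> assms show False by simp
qed

text \<open>Central binomial coefficients do not decrease with \<open>R\<close>, so from
  \<open>R_inf_star\<close> on the search always has a weight to choose.\<close>

lemma half_mem_weight_candidates:
  assumes "M \<ge> 2" "R_inf_star M \<le> R"
  shows "R div 2 \<in> weight_candidates M R"
proof -
  let ?I = "R_inf_star M"
  have "M \<le> ?I choose (?I div 2)"
    using R_inf_star_mem[OF assms(1)] by (simp add: unconstrained_rounds_def)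
  also have "\<dots> \<le> R choose (?I div 2)"
    using assms(2) by (rule binomial_right_mono)
  also have "\<dots> \<le> R choose (R div 2)"
    by (rule binomial_maximum)
  finally show ?thesis
    using R_inf_star_ge_2[OF assms(1)] assms(2) by (simp add: weight_candidates_def)
qed

lemma finite_weight_candidates: "finite (weight_candidates M R)"
  by (simp add: weight_candidates_def)

lemma min_weight_mem:
  assumes "weight_candidates M R \<noteq> {}"
  shows "min_weight M R \<in> weight_candidates M R"
  unfolding min_weight_def by (rule Min_in[OF finite_weight_candidates assms])

lemma min_weight_le:
  assumes "w \<in> weight_candidates M R"
  shows "min_weight M R \<le> w"
  unfolding min_weight_def by (rule Min_le[OF finite_weight_candidates assms])

text \<open>Reduces the existence of some admissible weight to the single test made by the search:
  the condition \<open>M * w \<le> R * Kmax\<close> is easiest for small weights, and a weight above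
  \<open>R div 2\<close> exceeds \<open>min_weight\<close> anyway.\<close>

lemma cw_rounds_iff:
  assumes "M \<ge> 2"
  shows "R \<in> cw_rounds M Kmax \<longleftrightarrow> R_inf_star M \<le> R \<and> M * min_weight M R \<le> R * Kmax"
proof
  assume "R \<in> cw_rounds M Kmax"
  then obtain w where w: "w \<in> {1..R}" "R choose w \<ge> M" "M * w \<le> R * Kmax" and "R \<ge> 1"
    by (auto simp: cw_rounds_def)
  have "R \<in> unconstrained_rounds M"
    using w \<open>R \<ge> 1\<close> binomial_maximum[of R w] by (simp add: unconstrained_rounds_def)
  then have inf: "R_inf_star M \<le> R"
    unfolding R_inf_star_def by (rule Least_le)
  have half: "min_weight M R \<le> R div 2"
    by (rule min_weight_le[OF half_mem_weight_candidates[OF assms inf]])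
  have "min_weight M R \<le> w"
  proof (cases "w \<le> R div 2")
    case True
    then have "w \<in> weight_candidates M R" using w by (simp add: weight_candidates_def)
    then show ?thesis by (rule min_weight_le)
  next
    case False
    then show ?thesis using half by linarith
  qed
  then have "M * min_weight M R \<le> M * w" by simp
  with w(3) inf show "R_inf_star M \<le> R \<and> M * min_weight M R \<le> R * Kmax" by linarith
next
  assume R: "R_inf_star M \<le> R \<and> M * min_weight M R \<le> R * Kmax"
  then have "min_weight M R \<in> weight_candidates M R"
    using half_mem_weight_candidates[OF assms] min_weight_mem by blast
  then have "min_weight M R \<in> {1..R}" "R choose min_weight M R \<ge> M"
    by (auto simp: weight_candidates_def)
  with R show "R \<in> cw_rounds M Kmax"
    by (auto simp: cw_rounds_def)
qed

lemma R_cw_star_mem: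
  assumes "M \<ge> 2" "Kmax \<ge> 1"
  shows "R_cw_star M Kmax \<in> cw_rounds M Kmax"
proof -
  have "M \<in> cw_rounds M Kmax"
    using assms by (auto simp: cw_rounds_def intro!: bexI[of _ 1])
  then show ?thesis unfolding R_cw_star_def by (rule LeastI)
qed

lemma R_cw_star_le: "R \<in> cw_rounds M Kmax \<Longrightarrow> R_cw_star M Kmax \<le> R"
  unfolding R_cw_star_def by (rule Least_le)

section \<open>Load balancing\<close>

lemma exchangeable_exists:
  assumes "finite F" "load F b < load F a"
  shows "\<exists>A. exchangeable F a b A"
proof (rule ccontr)
  assume none: "\<nexists>A. exchangeable F a b A"
  let ?Fa = "{A \<in> F. a \<in> A \<and> b \<notin> A}" and ?Fb = "{A \<in> F. b \<in> A \<and> a \<notin> A}"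
    and ?Fab = "{A \<in> F. a \<in> A \<and> b \<in> A}"
  have "a \<noteq> b" using assms(2) by auto
  \<comment> \<open>Members containing both rounds count equally in both loads, so only
    \<open>?Fa\<close> and \<open>?Fb\<close> have to be compared.\<close>
  have "{A \<in> F. a \<in> A} = ?Fa \<union> ?Fab" by auto
  moreover have "card (?Fa \<union> ?Fab) = card ?Fa + card ?Fab"
    by (rule card_Un_disjoint) (use assms(1) in auto)
  ultimately have a: "load F a = card ?Fa + card ?Fab" unfolding load_def by (rule ssubst)
  have "{A \<in> F. b \<in> A} = ?Fb \<union> ?Fab" by auto
  moreover have "card (?Fb \<union> ?Fab) = card ?Fb + card ?Fab"
    by (rule card_Un_disjoint) (use assms(1) in auto)
  ultimately have b: "load F b = card ?Fb + card ?Fab" unfolding load_def by (rule ssubst)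
  \<comment> \<open>Without an exchange, replacing \<open>a\<close> by \<open>b\<close> never leaves
    \<open>F\<close>, so it maps \<open>?Fa\<close> into \<open>?Fb\<close>; the reverse replacement
    is a left inverse.\<close>
  have "card ?Fa \<le> card ?Fb"
  proof (rule card_inj_on_le)
    show "inj_on (\<lambda>A. insert b (A - {a})) ?Fa"
    proof (rule inj_on_inverseI)
      fix A assume "A \<in> ?Fa"
      then show "insert a (insert b (A - {a}) - {b}) = A" using \<open>a \<noteq> b\<close> by auto
    qed
    show "(\<lambda>A. insert b (A - {a})) ` ?Fa \<subseteq> ?Fb"
      using none \<open>a \<noteq> b\<close> by (auto simp: exchangeable_def)
  qed (use assms(1) in simp)
  then show False using assms(2) a b by linarith
qed

text \<open>Justifies the incremental update of the load vector. The old and the new family are both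
  compared with their common part \<open>F - {A}\<close>; since the new set lies outside
  \<open>F\<close>, it is counted as an additional member.\<close>

lemma load_exchange:
  assumes "finite F" "exchangeable F a b A" "a \<noteq> b"
  shows "load (insert (insert b (A - {a})) (F - {A})) = (load F)(a := load F a - 1, b := load F b + 1)"
proof
  fix r
  let ?A' = "insert b (A - {a})"
  have A: "A \<in> F" "a \<in> A" "b \<notin> A" "?A' \<notin> F"
    using assms(2) by (auto simp: exchangeable_def)
  have rest: "load F r = load (F - {A}) r + (if r \<in> A then 1 else 0)"
  proof -
    have "{B \<in> F. r \<in> B} = (if r \<in> A then insert A {B \<in> F - {A}. r \<in> B} else {B \<in> F - {A}. r \<in> B})"
      using A by auto
    then show ?thesis unfolding load_def using assms(1) by simp
  qed
  have new: "load (insert ?A' (F - {A})) r = load (F - {A}) r + (if r \<in> ?A' then 1 else 0)"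
  proof -
    have "{B \<in> insert ?A' (F - {A}). r \<in> B} =
        (if r \<in> ?A' then insert ?A' {B \<in> F - {A}. r \<in> B} else {B \<in> F - {A}. r \<in> B})"
      by auto
    then show ?thesis unfolding load_def using assms(1) A by simp
  qed
  show "load (insert ?A' (F - {A})) r = ((load F)(a := load F a - 1, b := load F b + 1)) r"
    using rest new A assms(3) by auto
qed

text \<open>The weight survives because \<open>b\<close> was not in \<open>A\<close>, and the size
  of the family because the new set was not in \<open>F\<close>.\<close>

lemma subset_family_exchange:
  assumes "subset_family M R w F" "exchangeable F a b A" "b \<in> {1..R}"
  shows "subset_family M R w (insert (insert b (A - {a})) (F - {A}))"
proof -
  have A: "A \<in> F" "a \<in> A" "b \<notin> A" "insert b (A - {a}) \<notin> F"
    using assms(2) by (auto simp: exchangeable_def)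
  have F: "finite F" "card F = M" "\<forall>B\<in>F. B \<subseteq> {1..R} \<and> card B = w"
    using assms(1) by (auto simp: subset_family_def)
  have "finite A" using F(3) A(1) finite_subset by blast
  then have "card (insert b (A - {a})) = w"
    using A F(3) card_Suc_Diff1[of A a] by simp
  moreover have "card (insert (insert b (A - {a})) (F - {A})) = M"
    using F A card_Suc_Diff1[of F A] by simp
  ultimately show ?thesis
    using F A assms(3) by (auto simp: subset_family_def)
qed

definition potential :: "nat \<Rightarrow> (nat \<Rightarrow> nat) \<Rightarrow> nat" where
  "potential R K = (\<Sum>r\<in>{1..R}. (K r)\<^sup>2)"

lemma potential_exchange:
  assumes "a \<in> {1..R}" "b \<in> {1..R}" "K b + 1 < K a"
  shows "potential R (K(a := K a - 1, b := K b + 1)) < potential R K"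
proof -
  have "a \<noteq> b" using assms(3) by auto
  let ?I = "{1..R} - {a} - {b}" and ?K' = "K(a := K a - 1, b := K b + 1)"
  have split: "(\<Sum>r\<in>{1..R}. f r) = f a + (f b + (\<Sum>r\<in>?I. f r))" for f :: "nat \<Rightarrow> nat"
    using assms(1,2) \<open>a \<noteq> b\<close> sum.remove[of "{1..R}" a f] sum.remove[of "{1..R} - {a}" b f] by simp
  have rest: "(\<Sum>r\<in>?I. (?K' r)\<^sup>2) = (\<Sum>r\<in>?I. (K r)\<^sup>2)" by (rule sum.cong) auto
  \<comment> \<open>This form eliminates the truncated subtraction \<open>K a - 1\<close>; the sum
    of the two squares drops by \<open>2 * d + 2\<close>.\<close>
  obtain d where d: "K a = K b + 2 + d"
    using assms(3) less_iff_Suc_add by auto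
  have "(K a - 1)\<^sup>2 + (K b + 1)\<^sup>2 < (K a)\<^sup>2 + (K b)\<^sup>2"
    unfolding d by (simp add: power2_eq_square algebra_simps)
  then show ?thesis
    unfolding potential_def split[of "\<lambda>r. (?K' r)\<^sup>2"] split[of "\<lambda>r. (K r)\<^sup>2"] rest
    using \<open>a \<noteq> b\<close> by simp
qed

section \<open>Maximum, minimum and average load\<close>

lemma is_arg_max_max_load:
  assumes "is_arg_max K (\<lambda>r. r \<in> {1..R}) a"
  shows "max_load R K = K a"
  unfolding max_load_def
  using assms by (intro Max_eqI) (auto simp: is_arg_max_linorder)

lemma is_arg_min_min_load:
  assumes "is_arg_min K (\<lambda>r. r \<in> {1..R}) b"
  shows "min_load R K = K b"
  unfolding min_load_def
  using assms by (intro Min_eqI) (auto simp: is_arg_min_linorder)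

text \<open>Double counting of the pairs of a round and a member containing it.\<close>

lemma sum_load:
  assumes "subset_family M R w F"
  shows "(\<Sum>r\<in>{1..R}. load F r) = M * w"
proof -
  have "\<forall>A\<in>F. card {r \<in> {1..R}. r \<in> A} = w"
  proof
    fix A assume "A \<in> F"
    then have "A \<subseteq> {1..R}" "card A = w"
      using assms by (auto simp: subset_family_def)
    then have "{r \<in> {1..R}. r \<in> A} = A" "card A = w" by auto
    then show "card {r \<in> {1..R}. r \<in> A} = w" by simp
  qed
  then have "(\<Sum>r\<in>{1..R}. card {A \<in> F. r \<in> A}) = w * card F"
    using assms by (intro sum_multicount) (auto simp: subset_family_def)
  then show ?thesis
    using assms by (simp add: load_def subset_family_def mult.commute)
qed

lemma max_eq_ceiling_average:
  fixes K :: "nat \<Rightarrow> nat"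
  assumes "R \<ge> 1" "max_load R K \<le> min_load R K + 1"
  shows "int (max_load R K) = \<lceil>real (\<Sum>r\<in>{1..R}. K r) / real R\<rceil>"
proof -
  let ?m = "max_load R K" and ?s = "\<Sum>r\<in>{1..R}. K r"
  have ne: "K ` {1..R} \<noteq> {}" using assms(1) by auto
  have le: "K r \<le> ?m" "?m \<le> K r + 1" if "r \<in> {1..R}" for r
  proof -
    show "K r \<le> ?m" unfolding max_load_def using that by (intro Max_ge) auto
    have "min_load R K \<le> K r" unfolding min_load_def using that by (intro Min_le) auto
    with assms(2) show "?m \<le> K r + 1" by linarith
  qed
  have "?m \<in> K ` {1..R}" unfolding max_load_def using ne by (intro Max_in) auto
  then obtain a where a: "a \<in> {1..R}" "K a = ?m" by auto
  have "?s \<le> (\<Sum>r\<in>{1..R}. ?m)" by (rule sum_mono) (rule le)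
  then have upper: "?s \<le> R * ?m" by simp
  \<comment> \<open>Strict because round \<open>a\<close> attains the maximum; strictness here
    excludes \<open>?m - 1\<close> as the rounded-up average.\<close>
  have "(\<Sum>r\<in>{1..R}. ?m) < (\<Sum>r\<in>{1..R}. K r + 1)"
    by (rule sum_strict_mono_ex1) (use le(2) a in force)+
  then have "R * ?m < ?s + R" unfolding sum.distrib by simp
  then have "real R * real ?m < real ?s + real R"
    using of_nat_less_iff[where 'a = real, of "R * ?m" "?s + R"] by simp
  moreover have "real ?s \<le> real R * real ?m"
    using upper of_nat_le_iff[where 'a = real, of ?s "R * ?m"] by simp
  ultimately have "\<lceil>real ?s / real R\<rceil> = int ?m"
    using assms(1) by (intro ceiling_unique) (simp_all add: field_simps)
  then show ?thesis by simp
qed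

section \<open>Schedules and set families\<close>

text \<open>The lower bound for all competitors: feasibility makes the supports distinct
  \<open>w\<close>-subsets, and counting the ones of the matrix by rows and by columns gives the
  concurrency inequality.\<close>

lemma feasible_cw_schedule_cw_rounds:
  assumes "feasible_cw_schedule Kmax R M S"
  shows "R \<in> cw_rounds M Kmax"
proof -
  let ?C = "codeword_support R S"
  obtain w where w: "w \<in> {1..R}" "\<forall>m\<in>{1..M}. card (?C m) = w"
    using assms by (auto simp: feasible_cw_schedule_def constant_weight_def)
  have "inj_on ?C {1..M}"
  proof (rule inj_onI, rule ccontr)
    fix i j assume "i \<in> {1..M}" "j \<in> {1..M}" "?C i = ?C j" "i \<noteq> j"
    then obtain r where "r \<in> {1..R}" "S r i = 1" "S r j = 0"
      using assms unfolding feasible_cw_schedule_def bidirectionally_feasible_def by blast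
    then have "r \<in> ?C i" "r \<notin> ?C j" by (auto simp: codeword_support_def)
    with \<open>?C i = ?C j\<close> show False by simp
  qed
  then have "card {1..M} \<le> card {A. A \<subseteq> {1..R} \<and> card A = w}"
    by (rule card_inj_on_le) (use w in \<open>auto simp: codeword_support_def\<close>)
  then have "M \<le> R choose w" by (simp add: n_subsets)
  have "(\<Sum>r\<in>{1..R}. card {m \<in> {1..M}. S r m = 1}) = w * card {1..M}"
    using w(2) by (intro sum_multicount) (auto simp: codeword_support_def)
  moreover have "(\<Sum>r\<in>{1..R}. card {m \<in> {1..M}. S r m = 1}) \<le> (\<Sum>r\<in>{1..R}. Kmax)"
    using assms by (intro sum_mono) (auto simp: feasible_cw_schedule_def concurrency_limited_def)
  ultimately have "M * w \<le> R * Kmax" by (simp add: mult.commute)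
  with w(1) \<open>M \<le> R choose w\<close> show ?thesis
    by (auto simp: cw_rounds_def)
qed

text \<open>The columns are the indicator vectors of the members, numbered by an arbitrary bijection
  \<open>f\<close>; row \<open>r\<close> then has \<open>load F r\<close> ones.\<close>

lemma subset_family_schedule:
  assumes F: "subset_family M R w F" and "w \<in> {1..R}" and "max_load R (load F) \<le> Kmax"
  shows "\<exists>S. feasible_cw_schedule Kmax R M S \<and> bij_betw (codeword_support R S) {1..M} F"
proof -
  have mem: "A \<subseteq> {1..R}" "card A = w" if "A \<in> F" for A
    using F that by (auto simp: subset_family_def)
  have "finite F" "card F = card {1..M}" using F by (auto simp: subset_family_def)
  then obtain f where f: "bij_betw f {1..M} F"
    using finite_same_card_bij[of "{1..M}" F] by auto
  define S :: "nat \<Rightarrow> nat \<Rightarrow> nat" where "S r m = (if r \<in> f m then 1 else 0)" for r m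
  have fm: "f m \<in> F" if "m \<in> {1..M}" for m
    using f that by (auto simp: bij_betw_def)
  have supp: "codeword_support R S m = f m" if "m \<in> {1..M}" for m
    using mem(1)[OF fm[OF that]] by (auto simp: codeword_support_def S_def)
  have "bij_betw (codeword_support R S) {1..M} F"
    using f by (subst bij_betw_cong[where g = f]) (auto simp: supp)
  moreover have "schedule R M S" by (simp add: schedule_def S_def)
  moreover have "constant_weight R M S"
    unfolding constant_weight_def
  proof (intro bexI ballI)
    show "card (codeword_support R S m) = w" if "m \<in> {1..M}" for m
      unfolding supp[OF that] by (rule mem(2)[OF fm[OF that]])
  qed (rule assms(2))
  moreover have "bidirectionally_feasible R M S"
    unfolding bidirectionally_feasible_def
  proof (intro ballI impI)
    fix i j assume ij: "i \<in> {1..M}" "j \<in> {1..M}" "i \<noteq> j"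
    then have "f i \<noteq> f j" using f inj_onD unfolding bij_betw_def by metis
    moreover have "finite (f j)" using mem(1)[OF fm[OF ij(2)]] finite_subset by blast
    moreover have "card (f i) = card (f j)" using mem(2)[OF fm] ij by simp
    \<comment> \<open>Distinct finite sets of equal size are never nested.\<close>
    ultimately obtain r where r: "r \<in> f i" "r \<notin> f j"
      using card_subset_eq[of "f j" "f i"] by blast
    then have "r \<in> {1..R}" using mem(1)[OF fm[OF ij(1)]] by blast
    then show "\<exists>r\<in>{1..R}. S r i = 1 \<and> S r j = 0"
      by (rule bexI[rotated]) (simp add: S_def r)
  qed
  moreover have "concurrency_limited Kmax R M S"
    unfolding concurrency_limited_def
  proof
    fix r assume r: "r \<in> {1..R}"
    have "f ` {m \<in> {1..M}. S r m = 1} = {A \<in> F. r \<in> A}"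
      using f by (auto simp: bij_betw_def S_def)
    then have "bij_betw f {m \<in> {1..M}. S r m = 1} {A \<in> F. r \<in> A}"
      by (intro bij_betw_subset[OF f]) auto
    then have "card {m \<in> {1..M}. S r m = 1} = load F r"
      unfolding load_def by (rule bij_betw_same_card)
    also have "\<dots> \<le> max_load R (load F)"
      unfolding max_load_def using r by (intro Max_ge) auto
    finally show "card {m \<in> {1..M}. S r m = 1} \<le> Kmax" using assms(3) by linarith
  qed
  ultimately show ?thesis unfolding feasible_cw_schedule_def by blast
qed

section \<open>Executions\<close>

text \<open>The pair with which the search stops; it stays fixed in all later phases.\<close>

definition optimal_parameters :: "nat \<Rightarrow> nat \<Rightarrow> nat \<Rightarrow> nat \<Rightarrow> bool" where
  "optimal_parameters M Kmax R w \<longleftrightarrow> R = R_cw_star M Kmax \<and> w = min_weight M R"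

text \<open>The invariant of reachable configurations. In \<open>Search\<close>, the lower bound
  provides weight candidates and the upper bound says that the optimum has not been passed;
  \<open>K = load F\<close> ties the updated vector to the family.\<close>

fun valid_config :: "nat \<Rightarrow> nat \<Rightarrow> config \<Rightarrow> bool" where
  "valid_config M Kmax Start \<longleftrightarrow> True"
| "valid_config M Kmax (Search R) \<longleftrightarrow> R_inf_star M \<le> R \<and> R \<le> R_cw_star M Kmax"
| "valid_config M Kmax (Initialize R w) \<longleftrightarrow> optimal_parameters M Kmax R w"
| "valid_config M Kmax (Balance R w F K) \<longleftrightarrow>
     optimal_parameters M Kmax R w \<and> subset_family M R w F \<and> K = load F"
| "valid_config M Kmax (Exchange R w F K a b) \<longleftrightarrow>
     optimal_parameters M Kmax R w \<and> subset_family M R w F \<and> K = load F \<and>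
     a \<in> {1..R} \<and> b \<in> {1..R} \<and> K b + 1 < K a"
| "valid_config M Kmax (Returned R w F) \<longleftrightarrow>
     optimal_parameters M Kmax R w \<and> subset_family M R w F \<and>
     max_load R (load F) \<le> min_load R (load F) + 1"

lemma optimal_parametersD:
  assumes "M \<ge> 2" "Kmax \<ge> 1" "optimal_parameters M Kmax R w"
  shows "R \<in> cw_rounds M Kmax" "R \<ge> 1" "w \<in> {1..R}" "M \<le> R choose w" "M * w \<le> R * Kmax"
proof -
  show cw: "R \<in> cw_rounds M Kmax"
    using R_cw_star_mem assms by (auto simp: optimal_parameters_def)
  then show "R \<ge> 1" by (simp add: cw_rounds_def)
  have R: "R_inf_star M \<le> R" "M * min_weight M R \<le> R * Kmax"
    using cw cw_rounds_iff[OF assms(1)] by auto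
  then show "M * w \<le> R * Kmax" using assms(3) by (simp add: optimal_parameters_def)
  have "w \<in> weight_candidates M R"
    using min_weight_mem half_mem_weight_candidates[OF assms(1) R(1)] assms(3)
    by (auto simp: optimal_parameters_def)
  then show "w \<in> {1..R}" "M \<le> R choose w" by (auto simp: weight_candidates_def)
qed

lemma valid_config_step:
  assumes "M \<ge> 2" "Kmax \<ge> 1" "step M Kmax c c'" "valid_config M Kmax c"
  shows "valid_config M Kmax c'"
  using assms(3,4)
proof (cases rule: step.cases)
  case start
  then show ?thesis
    using cw_rounds_iff[OF assms(1)] R_cw_star_mem[OF assms(1,2)] by simp
next
  case (search_stop R)
  \<comment> \<open>The passed test gives \<open>R_cw_star M Kmax \<le> R\<close>; the invariant
    gives the converse.\<close>
  then have "R \<in> cw_rounds M Kmax"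
    using assms(4) cw_rounds_iff[OF assms(1)] by simp
  then show ?thesis
    using search_stop assms(4) R_cw_star_le[of R M Kmax] by (simp add: optimal_parameters_def)
next
  case (search_next R)
  \<comment> \<open>The test would succeed at the optimum, so after a failed test
    \<open>R + 1\<close> still respects the upper bound.\<close>
  then have "R \<noteq> R_cw_star M Kmax"
    using R_cw_star_mem[OF assms(1,2)] cw_rounds_iff[OF assms(1)] by blast
  then show ?thesis using search_next assms(4) by simp
next
  case (choose_rounds R K a b w F)
  then have "K b + 1 < K a"
    using is_arg_max_max_load[of K R a] is_arg_min_min_load[of K R b] by simp
  moreover have "a \<in> {1..R}" "b \<in> {1..R}"
    using choose_rounds by (auto simp: is_arg_max_def is_arg_min_def)
  ultimately show ?thesis using choose_rounds assms(4) by simp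
next
  case (exchange F a b A R w K)
  then have *: "subset_family M R w F" "load F b + 1 < load F a" "b \<in> {1..R}" "K = load F"
    "optimal_parameters M Kmax R w"
    using assms(4) by auto
  then have "finite F" "a \<noteq> b" by (auto simp: subset_family_def)
  then show ?thesis
    using exchange * load_exchange subset_family_exchange by simp
qed auto

lemma reachable_valid_config:
  assumes "M \<ge> 2" "Kmax \<ge> 1" "reachable M Kmax c"
  shows "valid_config M Kmax c"
  using assms(3) unfolding reachable_def
  by (induction rule: rtranclp_induct) (use valid_config_step[OF assms(1,2)] in auto)

lemma subset_family_exists:
  assumes "M \<le> R choose w"
  shows "\<exists>F. subset_family M R w F"
proof -
  let ?P = "{A. A \<subseteq> {1..R} \<and> card A = w}"
  have "M \<le> card ?P" using assms by (simp add: n_subsets)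
  then obtain F where "F \<subseteq> ?P" "card F = M" "finite F"
    by (rule obtain_subset_with_card_n)
  then have "subset_family M R w F" by (auto simp: subset_family_def)
  then show ?thesis ..
qed

text \<open>No deadlock: the invariant supplies a weight candidate, an initial family, extremal
  rounds or an exchange, whichever the next transition asks for.\<close>

lemma valid_config_progress:
  assumes "M \<ge> 2" "Kmax \<ge> 1" "valid_config M Kmax c" "\<nexists>R w F. c = Returned R w F"
  shows "\<exists>c'. step M Kmax c c'"
proof (cases c)
  case Start
  then show ?thesis
    using step.start mem_unconstrained_rounds_self[OF assms(1)] by blast
next
  case (Search R)
  then have "weight_candidates M R \<noteq> {}"
    using assms(3) half_mem_weight_candidates[OF assms(1)] by auto
  then show ?thesis using Search step.search_stop step.search_next by metis
next
  case (Initialize R w)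
  then have "M \<le> R choose w" using optimal_parametersD(4)[OF assms(1,2), of R w] assms(3) by simp
  then show ?thesis using Initialize subset_family_exists step.initialize by blast
next
  case (Balance R w F K)
  show ?thesis
  proof (cases "max_load R K > min_load R K + 1")
    case True
    have "R \<ge> 1" using Balance assms(3) optimal_parametersD(2)[OF assms(1,2), of R w] by simp
    then have fin: "finite (K ` {1..R})" "K ` {1..R} \<noteq> {}" by auto
    obtain a where "a \<in> {1..R}" "K a = Max (K ` {1..R})" using Max_in[OF fin] by auto
    then have a: "is_arg_max K (\<lambda>r. r \<in> {1..R}) a" by (auto simp: is_arg_max_linorder)
    obtain b where "b \<in> {1..R}" "K b = Min (K ` {1..R})" using Min_in[OF fin] by auto
    then have b: "is_arg_min K (\<lambda>r. r \<in> {1..R}) b" by (auto simp: is_arg_min_linorder)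
    show ?thesis using step.choose_rounds[OF True a b] Balance by blast
  next
    case False
    then show ?thesis using Balance step.finish by blast
  qed
next
  case (Exchange R w F K a b)
  then have "\<exists>A. exchangeable F a b A"
    using assms(3) by (intro exchangeable_exists) (auto simp: subset_family_def)
  then show ?thesis using Exchange step.exchange by blast
next
  case (Returned R w F)
  then show ?thesis using assms(4) by blast
qed

section \<open>Termination by a lexicographic measure\<close>

fun phase :: "config \<Rightarrow> nat" where
  "phase Start = 3"
| "phase (Search R) = 2"
| "phase (Initialize R w) = 1"
| "phase _ = 0"

text \<open>Second component, for steps within a phase. The summand 1 pays for choosing
  \<open>a\<close> and \<open>b\<close>, which leaves the potential unchanged, and for returning;
  the factor 2 lets an exchange, which lowers the potential, restore that summand and still
  decrease.\<close>

fun remaining :: "nat \<Rightarrow> nat \<Rightarrow> config \<Rightarrow> nat" where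
  "remaining M Kmax (Search R) = R_cw_star M Kmax - R"
| "remaining M Kmax (Balance R w F K) = 2 * potential R K + 1"
| "remaining M Kmax (Exchange R w F K a b) = 2 * potential R K"
| "remaining M Kmax _ = 0"

lemma step_decreases:
  assumes "M \<ge> 2" "Kmax \<ge> 1" "step M Kmax c c'" "valid_config M Kmax c"
  shows "(c', c) \<in> measures [phase, remaining M Kmax]"
  using assms(3)
proof (cases rule: step.cases)
  case (search_next R)
  \<comment> \<open>Validity of the successor yields \<open>R < R_cw_star M Kmax\<close>, without
    which the truncated difference need not decrease.\<close>
  then have "valid_config M Kmax (Search (R + 1))"
    using valid_config_step[OF assms] by simp
  then have "R < R_cw_star M Kmax" by simp
  then show ?thesis using search_next by simp
next
  case (exchange F a b A R w K)
  then have "a \<in> {1..R}" "b \<in> {1..R}" "K b + 1 < K a" using assms(4) by auto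
  from potential_exchange[OF this] show ?thesis using exchange by simp
qed simp_all

text \<open>The measure decreases from valid configurations only, so validity is first carried along
  the whole execution.\<close>

lemma no_infinite_execution:
  assumes "M \<ge> 2" "Kmax \<ge> 1"
  shows "\<nexists>c :: nat \<Rightarrow> config. c 0 = Start \<and> (\<forall>i. step M Kmax (c i) (c (Suc i)))"
proof
  assume "\<exists>c :: nat \<Rightarrow> config. c 0 = Start \<and> (\<forall>i. step M Kmax (c i) (c (Suc i)))"
  then obtain c :: "nat \<Rightarrow> config" where
    c: "c 0 = Start" "\<And>i. step M Kmax (c i) (c (Suc i))" by blast
  have "valid_config M Kmax (c i)" for i
    by (induction i) (use c valid_config_step[OF assms] in auto)
  then have "(c (Suc i), c i) \<in> measures [phase, remaining M Kmax]" for i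
    using step_decreases[OF assms c(2)] by blast
  then show False
    using wf_measures[of "[phase, remaining M Kmax]"] unfolding wf_iff_no_infinite_down_chain
    by blast
qed

section \<open>Properties of the output\<close>

lemma valid_config_Returned:
  assumes "M \<ge> 2" "Kmax \<ge> 1" "valid_config M Kmax (Returned R w F)"
  shows "int (max_load R (load F)) = \<lceil>real (M * w) / real R\<rceil>"
    "\<lceil>real (M * w) / real R\<rceil> \<le> int Kmax"
proof -
  have F: "subset_family M R w F" and p: "optimal_parameters M Kmax R w"
    and gap: "max_load R (load F) \<le> min_load R (load F) + 1"
    using assms(3) by auto
  have R: "R \<ge> 1" "M * w \<le> R * Kmax" using optimal_parametersD[OF assms(1,2) p] by auto
  show "int (max_load R (load F)) = \<lceil>real (M * w) / real R\<rceil>"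
    using max_eq_ceiling_average[OF R(1) gap] unfolding sum_load[OF F] .
  have "real (M * w) \<le> real (R * Kmax)" using R(2) by (rule of_nat_mono)
  then show "\<lceil>real (M * w) / real R\<rceil> \<le> int Kmax"
    using R(1) by (intro ceiling_le) (simp add: field_simps)
qed

theorem mainTheorem3:
  fixes M Kmax :: nat
  assumes "M \<ge> 2" and "Kmax \<ge> 1"
  shows
    \<comment> \<open>well-definedness: an execution can only stop by returning\<close>
    "(\<forall>c. reachable M Kmax c \<longrightarrow> (\<nexists>R w F. c = Returned R w F) \<longrightarrow> (\<exists>c'. step M Kmax c c'))
   \<and> (\<forall>R w F K a b. reachable M Kmax (Exchange R w F K a b) \<longrightarrow> (\<exists>A. exchangeable F a b A))
    \<comment> \<open>termination: there is no infinite execution\<close>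
   \<and> (\<nexists>c :: nat \<Rightarrow> config. c 0 = Start \<and> (\<forall>i. step M Kmax (c i) (c (Suc i))))
    \<comment> \<open>correctness and optimality of every possible output\<close>
   \<and> (\<forall>R w F. reachable M Kmax (Returned R w F) \<longrightarrow>
        subset_family M R w F
      \<and> R \<in> cw_rounds M Kmax \<and> R = R_cw_star M Kmax
      \<and> int (max_load R (load F)) = \<lceil>real (M * w) / real R\<rceil>
      \<and> \<lceil>real (M * w) / real R\<rceil> \<le> int Kmax
      \<and> (\<exists>S. feasible_cw_schedule Kmax R M S \<and> bij_betw (codeword_support R S) {1..M} F)
      \<and> (\<forall>R' S'. feasible_cw_schedule Kmax R' M S' \<longrightarrow> R \<le> R'))"
proof (intro conjI allI impI)
  fix c
  assume "reachable M Kmax c" "\<nexists>R w F. c = Returned R w F"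
  then show "\<exists>c'. step M Kmax c c'"
    using valid_config_progress reachable_valid_config assms by blast
next
  fix R w F K a b
  assume "reachable M Kmax (Exchange R w F K a b)"
  then have "valid_config M Kmax (Exchange R w F K a b)"
    using reachable_valid_config assms by blast
  then show "\<exists>A. exchangeable F a b A"
    by (intro exchangeable_exists) (auto simp: subset_family_def)
next
  show "\<nexists>c :: nat \<Rightarrow> config. c 0 = Start \<and> (\<forall>i. step M Kmax (c i) (c (Suc i)))"
    by (rule no_infinite_execution[OF assms])
next
  fix R w F
  assume "reachable M Kmax (Returned R w F)"
  then have valid: "valid_config M Kmax (Returned R w F)"
    using reachable_valid_config assms by blast
  then have F: "subset_family M R w F" and p: "optimal_parameters M Kmax R w" by auto
  note params = optimal_parametersD[OF assms p]
  note loads = valid_config_Returned[OF assms valid]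
  show "subset_family M R w F" by (rule F)
  show "R \<in> cw_rounds M Kmax" by (rule params(1))
  show R: "R = R_cw_star M Kmax" using p by (simp add: optimal_parameters_def)
  show "int (max_load R (load F)) = \<lceil>real (M * w) / real R\<rceil>" by (rule loads(1))
  show "\<lceil>real (M * w) / real R\<rceil> \<le> int Kmax" by (rule loads(2))
  have "max_load R (load F) \<le> Kmax" using loads by linarith
  then show "\<exists>S. feasible_cw_schedule Kmax R M S \<and> bij_betw (codeword_support R S) {1..M} F"
    by (rule subset_family_schedule[OF F params(3)])
  fix R' S'
  assume "feasible_cw_schedule Kmax R' M S'"
  \<comment> \<open>Every competing schedule has its number of rounds in
    \<open>cw_rounds M Kmax\<close>, whose least element is \<open>R\<close>.\<close>
  then show "R \<le> R'"
    unfolding R by (intro R_cw_star_le feasible_cw_schedule_cw_rounds)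
qed

end
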